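(* Let $V$ be a simple unitary vertex operator algebra and let $G$ be a compact group of unitary automorphisms of $V$. Let $U:=V^G=\{a\in V: ga=a \text{ for all } g\in G\}$ and assume that $U$ is an energy-bounded unitary subalgebra of $V$. Then $V$ is energy-bounded.
   Context: A simple unitary vertex operator algebra is a vertex operator algebra $V$ (over $\mathbb{C}$) of CFT type, i.e. $V=\bigoplus_{n\geq 0}V_n$ with $V_n=\ker(L_0-n1_V)$ and $V_0=\mathbb{C}\Omega$, with vacuum $\Omega$ and conformal vector $\nu$, $Y(\nu,z)=\sum_{n}L_nz^{-n-2}$, equipped with a scalar product $(\cdot|\cdot)$ with $(\Omega|\Omega)=1$ and an antilinear involution $a\mapsto a^*$ with $\nu^*=\nu$ such that $(b|a_nc)=(a^*_{-n}b|c)$ for all $a,b,c\in V$, $n\in\mathbb{Z}$. For $a\in V$ the modes $a_n$ are defined by $Y(z^{L_0}a,z)=\sum_{n}a_nz^{-n}$. Write $\|a\|=\sqrt{(a|a)}$, $V_{\leq n}=\bigoplus_{k\leq n}V_k$, $\|R\|_n:=\sup\{\|Rb\|: b\in V_{\leq n},\|b\|\leq 1\}\in[0,\infty]$. A vector $a$ satisfies energy bounds if there are real $s,C,t\geq0$ with $\|a_m\|_n\leq C(1+|m|)^t(1+|n|)^s$ for all $m,n\in\mathbb{Z}$; $V$ is energy-bounded if every $a\in V$ satisfies energy bounds. A unitary automorphism is a vertex operator algebra automorphism $g$ (preserving $\Omega,\nu$ and all products) with $(ga|gb)=(a|b)$ for all $a,b$. A unitary subalgebra of $V$ is a vertex subalgebra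 $U$ with $L_0U\subset U$ and $U^*=U$; it is energy-bounded if every $a\in U$ satisfies energy bounds. *)

theory Defs
  imports "HOL-Analysis.Analysis" "HOL-Library.Groups_Big_Fun"
begin

text \<open>Data of a (candidate) unitary vertex operator algebra on a carrier type 'v.
  sc: complex scalar multiplication; md a n b: the standard mode a_(n) b,
  i.e. Y(a,z) b = sum_n a_(n) b z^(-n-1); vac: vacuum; cv: conformal vector;
  ip: scalar product (linear in the first, antilinear in the second argument);
  star: the antilinear involution.\<close>

record 'v uvoa =
  sc :: "complex \<Rightarrow> 'v \<Rightarrow> 'v"
  md :: "'v \<Rightarrow> int \<Rightarrow> 'v \<Rightarrow> 'v"
  vac :: 'v
  cv :: 'v
  ip :: "'v \<Rightarrow> 'v \<Rightarrow> complex"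
  star :: "'v \<Rightarrow> 'v"

definition Lop :: "('v, 'b) uvoa_scheme \<Rightarrow> int \<Rightarrow> 'v \<Rightarrow> 'v" where
  "Lop V n = md V (cv V) (n + 1)"

definition Vhom :: "('v::ab_group_add, 'b) uvoa_scheme \<Rightarrow> int \<Rightarrow> 'v set" where
  "Vhom V d = {a. Lop V 0 a = sc V (of_int d) a}"

definition hdecomp :: "('v::ab_group_add, 'b) uvoa_scheme \<Rightarrow> 'v \<Rightarrow> (nat \<Rightarrow> 'v) \<Rightarrow> bool" where
  "hdecomp V a f \<longleftrightarrow> finite {k. f k \<noteq> 0} \<and> (\<forall>k. f k \<in> Vhom V (int k)) \<and> a = Sum_any f"

definition hc :: "('v::ab_group_add, 'b) uvoa_scheme \<Rightarrow> nat \<Rightarrow> 'v \<Rightarrow> 'v" where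
  "hc V d a = (THE b. \<exists>f. hdecomp V a f \<and> b = f d)"

text \<open>The modes a_m of the paper: Y(z^(L_0) a, z) = sum_m a_m z^(-m);
  for a in V_d this is a_m = a_(m+d-1).\<close>
definition smd :: "('v::ab_group_add, 'b) uvoa_scheme \<Rightarrow> 'v \<Rightarrow> int \<Rightarrow> 'v \<Rightarrow> 'v" where
  "smd V a m b = Sum_any (\<lambda>d::nat. md V (hc V d a) (m + int d - 1) b)"

definition is_voa :: "('v::ab_group_add, 'b) uvoa_scheme \<Rightarrow> bool" where
  "is_voa V \<longleftrightarrow>
     vector_space (sc V)
   \<and> (\<forall>a n. Vector_Spaces.linear (sc V) (sc V) (md V a n))
   \<and> (\<forall>a b n c. md V (a + b) n c = md V a n c + md V b n c)
   \<and> (\<forall>a x n c. md V (sc V x a) n c = sc V x (md V a n c))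
   \<and> (\<forall>a b. \<exists>N. \<forall>n\<ge>N. md V a n b = 0)
   \<and> (\<forall>n b. md V (vac V) n b = (if n = -1 then b else 0))
   \<and> (\<forall>a. md V a (-1) (vac V) = a \<and> (\<forall>n\<ge>0. md V a n (vac V) = 0))
   \<and> (\<forall>a b c m n r.
        Sum_any (\<lambda>i::nat. sc V ((of_int m :: complex) gchoose i) (md V (md V a (r + int i) b) (m + n - int i) c))
      = Sum_any (\<lambda>i::nat. sc V ((-1) ^ i * ((of_int r :: complex) gchoose i))
            (md V a (m + r - int i) (md V b (n + int i) c)
             - sc V ((-1) powi r) (md V b (n + r - int i) (md V a (m + int i) c)))))
   \<and> cv V \<in> Vhom V 2
   \<and> (\<exists>c::complex. \<forall>m n b.
        Lop V m (Lop V n b) - Lop V n (Lop V m b)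
      = sc V (of_int (m - n)) (Lop V (m + n) b)
        + (if m + n = 0 then sc V (c / 12 * (of_int m ^ 3 - of_int m)) b else 0))
   \<and> (\<forall>a n b. md V (Lop V (-1) a) n b = sc V (- of_int n) (md V a (n - 1) b))
   \<and> (\<forall>a. \<exists>f. hdecomp V a f)
   \<and> (\<forall>k::nat. \<exists>B. finite B \<and> B \<subseteq> Vhom V (int k) \<and> module.span (sc V) B = Vhom V (int k))
   \<and> Vhom V 0 = range (\<lambda>x. sc V x (vac V))"

definition voa_ideal :: "('v::ab_group_add, 'b) uvoa_scheme \<Rightarrow> 'v set \<Rightarrow> bool" where
  "voa_ideal V I \<longleftrightarrow> module.subspace (sc V) I
     \<and> (\<forall>a b n. b \<in> I \<longrightarrow> md V a n b \<in> I \<and> md V b n a \<in> I)"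

definition is_simple_voa :: "('v::ab_group_add, 'b) uvoa_scheme \<Rightarrow> bool" where
  "is_simple_voa V \<longleftrightarrow> is_voa V \<and> (\<forall>I. voa_ideal V I \<longrightarrow> I = {0} \<or> I = UNIV)"

definition is_unitary_voa :: "('v::ab_group_add, 'b) uvoa_scheme \<Rightarrow> bool" where
  "is_unitary_voa V \<longleftrightarrow> is_voa V
   \<and> (\<forall>a b c. ip V (a + b) c = ip V a c + ip V b c)
   \<and> (\<forall>x a b. ip V (sc V x a) b = x * ip V a b)
   \<and> (\<forall>a b. ip V a b = cnj (ip V b a))
   \<and> (\<forall>a. a \<noteq> 0 \<longrightarrow> Re (ip V a a) > 0)
   \<and> ip V (vac V) (vac V) = 1
   \<and> (\<forall>a b. star V (a + b) = star V a + star V b)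
   \<and> (\<forall>x a. star V (sc V x a) = sc V (cnj x) (star V a))
   \<and> (\<forall>a. star V (star V a) = a)
   \<and> star V (cv V) = cv V
   \<and> (\<forall>a b c n. ip V b (smd V a n c) = ip V (smd V (star V a) (- n) b) c)"

definition vnorm :: "('v, 'b) uvoa_scheme \<Rightarrow> 'v \<Rightarrow> real" where
  "vnorm V a = sqrt (Re (ip V a a))"

definition Vle :: "('v::ab_group_add, 'b) uvoa_scheme \<Rightarrow> int \<Rightarrow> 'v set" where
  "Vle V n = module.span (sc V) (\<Union>k\<in>{..n}. Vhom V k)"

definition opn :: "('v::ab_group_add, 'b) uvoa_scheme \<Rightarrow> ('v \<Rightarrow> 'v) \<Rightarrow> int \<Rightarrow> ennreal" where
  "opn V R n = Sup {ennreal (vnorm V (R b)) | b. b \<in> Vle V n \<and> vnorm V b \<le> 1}"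

definition energy_bounds :: "('v::ab_group_add, 'b) uvoa_scheme \<Rightarrow> 'v \<Rightarrow> bool" where
  "energy_bounds V a \<longleftrightarrow> (\<exists>s C t::real. s \<ge> 0 \<and> C \<ge> 0 \<and> t \<ge> 0 \<and>
     (\<forall>m n::int. opn V (smd V a m) n
        \<le> ennreal (C * (1 + real_of_int \<bar>m\<bar>) powr t * (1 + real_of_int \<bar>n\<bar>) powr s)))"

definition energy_bounded :: "('v::ab_group_add, 'b) uvoa_scheme \<Rightarrow> bool" where
  "energy_bounded V \<longleftrightarrow> (\<forall>a. energy_bounds V a)"

definition unitary_aut :: "('v::ab_group_add, 'b) uvoa_scheme \<Rightarrow> ('v \<Rightarrow> 'v) \<Rightarrow> bool" where
  "unitary_aut V g \<longleftrightarrow> bij g \<and> Vector_Spaces.linear (sc V) (sc V) g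
     \<and> g (vac V) = vac V \<and> g (cv V) = cv V
     \<and> (\<forall>a n b. g (md V a n b) = md V (g a) n (g b))
     \<and> (\<forall>a b. ip V (g a) (g b) = ip V a b)"

definition strong_top :: "('v::ab_group_add, 'b) uvoa_scheme \<Rightarrow> ('v \<Rightarrow> 'v) topology" where
  "strong_top V = product_topology (\<lambda>_. Metric_space.mtopology UNIV (\<lambda>x y. vnorm V (x - y))) UNIV"

definition compact_unitary_aut_group :: "('v::ab_group_add, 'b) uvoa_scheme \<Rightarrow> ('v \<Rightarrow> 'v) set \<Rightarrow> bool" where
  "compact_unitary_aut_group V G \<longleftrightarrow> (\<forall>g\<in>G. unitary_aut V g) \<and> id \<in> G
     \<and> (\<forall>g\<in>G. \<forall>h\<in>G. g \<circ> h \<in> G) \<and> (\<forall>g\<in>G. inv g \<in> G)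
     \<and> compactin (strong_top V) G"

definition fixed_points :: "('v \<Rightarrow> 'v) set \<Rightarrow> 'v set" where
  "fixed_points G = {a. \<forall>g\<in>G. g a = a}"

definition unitary_subalgebra :: "('v::ab_group_add, 'b) uvoa_scheme \<Rightarrow> 'v set \<Rightarrow> bool" where
  "unitary_subalgebra V U \<longleftrightarrow> module.subspace (sc V) U \<and> vac V \<in> U
     \<and> (\<forall>a\<in>U. \<forall>b\<in>U. \<forall>n. md V a n b \<in> U)
     \<and> (\<forall>a\<in>U. Lop V 0 a \<in> U) \<and> star V ` U = U"

definition energy_bounded_subalgebra :: "('v::ab_group_add, 'b) uvoa_scheme \<Rightarrow> 'v set \<Rightarrow> bool" where
  "energy_bounded_subalgebra V U \<longleftrightarrow> unitary_subalgebra V U \<and> (\<forall>a\<in>U. energy_bounds V a)"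

end

(* If q in V_d is quasi-primary (L_1 q = 0), then its star q' lies in V_d again (in general the star
   of a homogeneous vector is not even homogeneous). For an orthonormal basis E of the space of
   quasi-primary vectors of V_d, the vectors c_j = sum_{e in E} e'_(j) e are G-invariant, because G
   permutes the orthonormal bases of this space. The Borcherds identity for e', e with r = -1 has
   only plus signs on its right-hand side, and with m = d-k and n = k+d-1 its sum over E becomes
     sum_{i < M} binom(d-k, i) (c_{i-1})_0
       = sum_{e in E} sum_{i >= 0} (e'_{-k-i} e_{k+i} + e_{k-1-i} e'_{1-k+i}),
   where each term on the right is of the form T^+ T and hence positive. Dropping all terms but one
   bounds e_k by finitely many zero modes of elements of V^G, with coefficients polynomial in k.
   Since V_d is the orthogonal sum of its quasi-primary vectors and L_{-1} V_{d-1}, and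
   (L_{-1} a)_n = -(n+d) a_n for a in V_d, induction on d gives energy bounds for all vectors. *)

theory Submission
  imports Defs
begin

section \<open>The axioms of a unitary vertex operator algebra as separate rules\<close>

locale unitary_voa =
  fixes V :: "('v::ab_group_add) uvoa"
  assumes unitary: "is_unitary_voa V"
begin

lemma voa: "is_voa V"
  using unitary by (simp add: is_unitary_voa_def)

sublocale vector_space "sc V"
  using voa by (simp add: is_voa_def)

lemma md_linear: "\<forall>a n. Vector_Spaces.linear (sc V) (sc V) (md V a n)"
  using voa unfolding is_voa_def by (elim conjE)

lemma md_add_left [rule_format]: "\<forall>a b n c. md V (a + b) n c = md V a n c + md V b n c"
  using voa unfolding is_voa_def by (elim conjE)

lemma md_scale_left [rule_format]: "\<forall>a x n c. md V (sc V x a) n c = sc V x (md V a n c)"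
  using voa unfolding is_voa_def by (elim conjE)

lemma md_truncation [rule_format]: "\<forall>a b. \<exists>N. \<forall>n\<ge>N. md V a n b = 0"
  using voa unfolding is_voa_def by (elim conjE)

lemma md_vacuum_all: "\<forall>a. md V a (-1) (vac V) = a \<and> (\<forall>n\<ge>0. md V a n (vac V) = 0)"
  using voa unfolding is_voa_def by (elim conjE)

lemma md_vacuum: "md V a (-1) (vac V) = a"
  and md_vacuum_nonneg: "n \<ge> 0 \<Longrightarrow> md V a n (vac V) = 0"
  using md_vacuum_all by blast+

lemma borcherds [rule_format]:
  "\<forall>a b c m n r. Sum_any (\<lambda>i::nat. sc V ((of_int m :: complex) gchoose i) (md V (md V a (r + int i) b) (m + n - int i) c))
   = Sum_any (\<lambda>i::nat. sc V ((-1) ^ i * ((of_int r :: complex) gchoose i))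
       (md V a (m + r - int i) (md V b (n + int i) c)
        - sc V ((-1) powi r) (md V b (n + r - int i) (md V a (m + int i) c))))"
  using voa unfolding is_voa_def by (elim conjE)

lemma cv_Vhom: "cv V \<in> Vhom V 2"
  using voa unfolding is_voa_def by (elim conjE)

lemma md_translation [rule_format]:
  "\<forall>a n b. md V (Lop V (-1) a) n b = sc V (- of_int n) (md V a (n - 1) b)"
  using voa unfolding is_voa_def by (elim conjE)

lemma ex_hdecomp [rule_format]: "\<forall>a. \<exists>f. hdecomp V a f"
  using voa unfolding is_voa_def by (elim conjE)

lemma Vhom_finite_span [rule_format]:
  "\<forall>k::nat. \<exists>B. finite B \<and> B \<subseteq> Vhom V (int k) \<and> span B = Vhom V (int k)"
  using voa unfolding is_voa_def by (elim conjE)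

lemma ip_add_left [rule_format]: "\<forall>a b c. ip V (a + b) c = ip V a c + ip V b c"
  using unitary unfolding is_unitary_voa_def by (elim conjE)

lemma ip_scale_left [rule_format]: "\<forall>x a b. ip V (sc V x a) b = x * ip V a b"
  using unitary unfolding is_unitary_voa_def by (elim conjE)

lemma ip_pos [rule_format]: "\<forall>a. a \<noteq> 0 \<longrightarrow> Re (ip V a a) > 0"
  using unitary unfolding is_unitary_voa_def by (elim conjE)

lemma star_add [rule_format]: "\<forall>a b. star V (a + b) = star V a + star V b"
  using unitary unfolding is_unitary_voa_def by (elim conjE)

lemma star_scale [rule_format]: "\<forall>x a. star V (sc V x a) = sc V (cnj x) (star V a)"
  using unitary unfolding is_unitary_voa_def by (elim conjE)

lemma star_star [rule_format]: "\<forall>a. star V (star V a) = a"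
  using unitary unfolding is_unitary_voa_def by (elim conjE)

lemma star_cv: "star V (cv V) = cv V"
  using unitary unfolding is_unitary_voa_def by (elim conjE)

lemma ip_cnj [rule_format]: "\<forall>a b. ip V a b = cnj (ip V b a)"
  using unitary unfolding is_unitary_voa_def by (elim conjE)

lemma smd_adjoint [rule_format]:
  "\<forall>a b c n. ip V b (smd V a n c) = ip V (smd V (star V a) (- n) b) c"
  using unitary unfolding is_unitary_voa_def by (elim conjE)

section \<open>Linearity of the modes and sesquilinearity of the scalar product\<close>

lemma md_add: "md V a n (b + c) = md V a n b + md V a n c"
  and md_scale: "md V a n (sc V x b) = sc V x (md V a n b)"
proof -
  interpret l: Vector_Spaces.linear "sc V" "sc V" "md V a n"
    using md_linear by blast
  show "md V a n (b + c) = md V a n b + md V a n c" "md V a n (sc V x b) = sc V x (md V a n b)"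
    by (rule l.add l.scale)+
qed

lemma md_zero [simp]: "md V a n 0 = 0"
  using md_add[of a n 0 0] by simp

lemma md_zero_left [simp]: "md V 0 n b = 0"
  using md_add_left[of 0 0 n b] by simp

lemma md_sum: "md V a n (sum f S) = (\<Sum>i\<in>S. md V a n (f i))"
  by (induction S rule: infinite_finite_induct) (simp_all add: md_add)

lemma md_sum_left: "md V (sum f S) n b = (\<Sum>i\<in>S. md V (f i) n b)"
  by (induction S rule: infinite_finite_induct) (simp_all add: md_add_left)

lemma Lop_add: "Lop V n (a + b) = Lop V n a + Lop V n b"
  and Lop_scale: "Lop V n (sc V x a) = sc V x (Lop V n a)"
  and Lop_zero [simp]: "Lop V n 0 = 0"
  and Lop_sum: "Lop V n (sum f S) = (\<Sum>i\<in>S. Lop V n (f i))"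
  by (simp_all add: Lop_def md_add md_scale md_sum)

lemma ip_add_right: "ip V a (b + c) = ip V a b + ip V a c"
  by (subst ip_cnj) (simp add: ip_add_left flip: ip_cnj)

lemma ip_scale_right: "ip V a (sc V x b) = cnj x * ip V a b"
  by (subst ip_cnj) (simp add: ip_scale_left flip: ip_cnj)

lemma ip_zero [simp]: "ip V 0 b = 0" "ip V a 0 = 0"
  using ip_add_left[of 0 0 b] ip_add_right[of a 0 0] by simp_all

lemma ip_minus: "ip V (- a) b = - ip V a b" "ip V a (- b) = - ip V a b"
  using ip_add_left[of a "- a" b] ip_add_right[of a b "- b"]
  by (simp_all add: eq_neg_iff_add_eq_0 add.commute)

lemma ip_diff_left: "ip V (a - b) c = ip V a c - ip V b c"
  using ip_add_left[of a "- b" c] by (simp add: ip_minus)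

lemma ip_diff_right: "ip V a (b - c) = ip V a b - ip V a c"
  using ip_add_right[of a b "- c"] by (simp add: ip_minus)

lemma ip_sum_left: "ip V (sum f S) b = (\<Sum>i\<in>S. ip V (f i) b)"
  by (induction S rule: infinite_finite_induct) (simp_all add: ip_add_left)

lemma ip_sum_right: "ip V a (sum f S) = (\<Sum>i\<in>S. ip V a (f i))"
  by (induction S rule: infinite_finite_induct) (simp_all add: ip_add_right)

lemma ip_self_nonneg: "Re (ip V a a) \<ge> 0"
  using ip_pos[of a] by (cases "a = 0") auto

lemma ip_self_eq_0: "ip V a a = 0 \<Longrightarrow> a = 0"
  using ip_pos[of a] by fastforce

lemma eq_if_ip_right_eq:
  assumes "\<And>b. ip V b x = ip V b y"
  shows "x = y"
  using ip_self_eq_0[of "x - y"] assms by (simp add: ip_diff_right)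

lemma eq_if_ip_left_eq:
  assumes "\<And>b. ip V x b = ip V y b"
  shows "x = y"
  using ip_self_eq_0[of "x - y"] assms by (simp add: ip_diff_left)

section \<open>Norm, Cauchy-Schwarz inequality and triangle inequality\<close>

lemma vnorm_nonneg: "vnorm V a \<ge> 0"
  by (simp add: vnorm_def ip_self_nonneg)

lemma vnorm_sq: "(vnorm V a)\<^sup>2 = Re (ip V a a)"
  by (simp add: vnorm_def ip_self_nonneg)

lemma ip_self: "ip V a a = of_real ((vnorm V a)\<^sup>2)"
proof -
  have "Im (ip V a a) = 0"
    using arg_cong[OF ip_cnj[of a a], of Im] by simp
  then show ?thesis
    by (simp add: vnorm_sq complex_eq_iff)
qed

lemma cauchy_schwarz: "cmod (ip V a b) \<le> vnorm V a * vnorm V b"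
proof (cases "b = 0")
  case True
  then show ?thesis by (simp add: vnorm_def)
next
  case False
  define p where "p = (vnorm V b)\<^sup>2"
  \<comment> \<open>\<open>w\<close> is \<open>p\<close> times the component of \<open>a\<close>
    orthogonal to \<open>b\<close>. Scaling by \<open>p\<close> avoids a division, and the squared
    norm of \<open>w\<close> is \<open>p\<close> times the Gram determinant of \<open>a\<close> and
    \<open>b\<close>.\<close>
  define w where "w = sc V (of_real p) a - sc V (ip V a b) b"
  have ba: "ip V b a = cnj (ip V a b)" by (rule ip_cnj)
  have p: "p > 0" unfolding p_def vnorm_sq using ip_pos False by blast
  have "ip V w w = of_real (p * (p * (vnorm V a)\<^sup>2 - (cmod (ip V a b))\<^sup>2))"
    using ba
    by (simp add: w_def ip_diff_left ip_diff_right ip_scale_left ip_scale_right ip_self[of a] ip_self[of b]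
        p_def power2_eq_square algebra_simps flip: complex_norm_square)
  then have "0 \<le> p * (p * (vnorm V a)\<^sup>2 - (cmod (ip V a b))\<^sup>2)"
    using ip_self_nonneg[of w] by simp
  then have "(cmod (ip V a b))\<^sup>2 \<le> (vnorm V a * vnorm V b)\<^sup>2"
    using p by (simp add: zero_le_mult_iff p_def power_mult_distrib mult.commute)
  then show ?thesis
    by (rule power2_le_imp_le) (simp add: vnorm_nonneg)
qed

lemma vnorm_add: "vnorm V (a + b) \<le> vnorm V a + vnorm V b"
proof (rule power2_le_imp_le)
  have "Re (ip V a b) \<le> vnorm V a * vnorm V b" "Re (ip V b a) \<le> vnorm V b * vnorm V a"
    using cauchy_schwarz complex_Re_le_cmod order_trans by blast+
  then show "(vnorm V (a + b))\<^sup>2 \<le> (vnorm V a + vnorm V b)\<^sup>2"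
    by (simp add: power2_sum) (simp add: vnorm_sq ip_add_left ip_add_right algebra_simps)
qed (simp add: vnorm_nonneg)

lemma vnorm_zero [simp]: "vnorm V 0 = 0"
  by (simp add: vnorm_def)

lemma vnorm_scale: "vnorm V (sc V x a) = cmod x * vnorm V a"
proof (rule power2_eq_imp_eq)
  have "ip V (sc V x a) (sc V x a) = (x * cnj x) * ip V a a"
    by (simp add: ip_scale_left ip_scale_right)
  also have "\<dots> = of_real ((cmod x)\<^sup>2 * (vnorm V a)\<^sup>2)"
    by (simp only: ip_self[of a] flip: complex_norm_square of_real_mult)
  finally have "ip V (sc V x a) (sc V x a) = of_real ((cmod x)\<^sup>2 * (vnorm V a)\<^sup>2)" .
  then show "(vnorm V (sc V x a))\<^sup>2 = (cmod x * vnorm V a)\<^sup>2"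
    by (simp add: vnorm_sq power_mult_distrib)
qed (simp_all add: vnorm_nonneg)

section \<open>Orthonormal sets and change of basis\<close>

definition orthonormal_set :: "'v set \<Rightarrow> bool" where
  "orthonormal_set E \<longleftrightarrow> finite E \<and> (\<forall>e\<in>E. \<forall>f\<in>E. ip V e f = (if e = f then 1 else 0))"

lemma orthonormal_expansion:
  assumes "orthonormal_set E" "x \<in> span E"
  shows "x = (\<Sum>e\<in>E. sc V (ip V x e) e)"
proof -
  have E: "finite E" using assms by (simp add: orthonormal_set_def)
  obtain u where u: "x = (\<Sum>e\<in>E. sc V (u e) e)"
    using assms(2) span_finite[OF E] by auto
  have "ip V x f = u f" if "f \<in> E" for f
  proof -
    have "ip V x f = (\<Sum>e\<in>E. if e = f then u e else 0)"
      unfolding u ip_sum_left ip_scale_left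
      by (rule sum.cong) (use assms that in \<open>auto simp: orthonormal_set_def\<close>)
    then show ?thesis using that E by simp
  qed
  then show ?thesis using u by simp
qed

lemma orthogonal_residual:
  assumes "orthonormal_set E" "f \<in> span E"
  shows "ip V (x - (\<Sum>e\<in>E. sc V (ip V x e) e)) f = 0"
proof -
  let ?w = "x - (\<Sum>e\<in>E. sc V (ip V x e) e)"
  have E: "finite E" using assms by (simp add: orthonormal_set_def)
  have *: "ip V ?w f = 0" if "f \<in> E" for f
  proof -
    have "(\<Sum>e\<in>E. ip V x e * ip V e f) = (\<Sum>e\<in>E. if e = f then ip V x e else 0)"
      by (rule sum.cong) (use assms that in \<open>auto simp: orthonormal_set_def\<close>)
    then show ?thesis using that E by (simp add: ip_diff_left ip_sum_left ip_scale_left)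
  qed
  have "f = (\<Sum>e\<in>E. sc V (ip V f e) e)" by (rule orthonormal_expansion[OF assms])
  then have "ip V ?w f = ip V ?w (\<Sum>e\<in>E. sc V (ip V f e) e)" by simp
  also have "\<dots> = (\<Sum>e\<in>E. cnj (ip V f e) * ip V ?w e)"
    by (simp only: ip_sum_right ip_scale_right)
  also have "\<dots> = 0" using * by (intro sum.neutral) simp
  finally show ?thesis .
qed

text \<open>Gram-Schmidt, one generator at a time. If the residual \<open>w\<close> of the new
  generator is zero, the generator already lies in the span and is dropped; otherwise
  \<open>w\<close> is normalised and joins \<open>E\<close>.\<close>

lemma ex_orthonormal_basis_span:
  assumes "finite B"
  shows "\<exists>E. orthonormal_set E \<and> span E = span B"
  using assms
proof induction
  case empty
  show ?case by (rule exI[of _ "{}"]) (simp add: orthonormal_set_def)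
next
  case (insert v B)
  then obtain E where E: "orthonormal_set E" and sp: "span E = span B" by blast
  define p where "p = (\<Sum>e\<in>E. sc V (ip V v e) e)"
  define w where "w = v - p"
  have p: "p \<in> span E" unfolding p_def by (intro span_sum span_scale span_base)
  have ins: "span (insert v B) = span (insert w E)"
    using eq_span_insert_eq[of v w E] p span_insert[of v B] span_insert[of v E]
    by (simp add: w_def sp)
  show ?case
  proof (cases "w = 0")
    case True
    then show ?thesis using E ins by (metis span_insert_0)
  next
    case False
    define r where "r = vnorm V w"
    have r: "r > 0" using ip_pos[OF False] by (simp add: r_def vnorm_def)
    define u where "u = sc V (of_real (1 / r)) w"
    have w: "w = sc V (of_real r) u" using r by (simp add: u_def)
    have uu: "ip V u u = 1"
      using r by (simp add: u_def ip_scale_left ip_scale_right ip_self[of w] power2_eq_square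
          flip: of_real_mult r_def)
    have ue: "ip V u e = 0" if "e \<in> E" for e
      using orthogonal_residual[OF E span_base[OF that], of v]
      by (simp add: u_def ip_scale_left w_def p_def)
    have eu: "ip V e u = 0" if "e \<in> E" for e
      using ue[OF that] by (subst ip_cnj) simp
    have "orthonormal_set (insert u E)"
      using E uu ue eu by (auto simp: orthonormal_set_def)
    moreover have "span (insert u E) = span (insert w E)"
      unfolding span_eq
    proof
      have "w \<in> span (insert u E)" unfolding w by (intro span_scale span_base) simp
      then show "insert w E \<subseteq> span (insert u E)" by (auto intro: span_base)
      have "u \<in> span (insert w E)" unfolding u_def by (intro span_scale span_base) simp
      then show "insert u E \<subseteq> span (insert w E)" by (auto intro: span_base)
    qed
    ultimately show ?thesis using ins by metis
  qed
qed

text \<open>An independent set inside the span of the finite set \<open>B\<close> is finite, so a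
  basis of \<open>W\<close> can be fed to Gram-Schmidt.\<close>

lemma ex_orthonormal_basis:
  assumes "subspace W" "W \<subseteq> span B" "finite B"
  shows "\<exists>E. orthonormal_set E \<and> span E = W"
proof -
  obtain C where C: "C \<subseteq> W" "independent C" "W \<subseteq> span C"
    using basis_exists[of W] by metis
  have "finite C"
    using independent_span_bound[OF assms(3) C(2)] C(1) assms(2) by blast
  moreover have "span C = W"
    using C assms(1) by (simp add: span_minimal subset_antisym)
  ultimately show ?thesis using ex_orthonormal_basis_span by metis
qed

text \<open>A change of orthonormal basis is unitary. Expanding each \<open>f\<close> in
  \<open>E\<close> gives \<open>B e e'\<close> the coefficient \<open>ip V e f * ip V f e'\<close>,
  and summed over \<open>F\<close> these coefficients give \<open>ip V e e'\<close>, by the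
  expansion of \<open>e\<close> in \<open>F\<close>. The form takes values in the space itself
  because it is meant for \<open>md V (star V x) j y\<close>, which is antilinear in
  \<open>x\<close>.\<close>

lemma sesquilinear_trace_basis_independent:
  assumes E: "orthonormal_set E" and F: "orthonormal_set F" and EF: "span E = span F"
    and "\<And>x y z. B (x + y) z = B x z + B y z" and "\<And>x y z. B z (x + y) = B z x + B z y"
    and "\<And>c x y. B (sc V c x) y = sc V (cnj c) (B x y)" and "\<And>c x y. B x (sc V c y) = sc V c (B x y)"
  shows "(\<Sum>f\<in>F. B f f) = (\<Sum>e\<in>E. B e e)"
proof -
  have B0: "B 0 z = 0" "B z 0 = 0" for z
    using assms(4)[of 0 0 z] assms(5)[of z 0 0] by simp_all
  have Bs: "B (sum g S) z = (\<Sum>i\<in>S. B (g i) z)" "B z (sum g S) = (\<Sum>i\<in>S. B z (g i))" for g S z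
    by (induction S rule: infinite_finite_induct) (simp_all add: B0 assms(4,5))
  have fin: "finite E" using E by (simp add: orthonormal_set_def)
  have "B f f = (\<Sum>e\<in>E. \<Sum>e'\<in>E. sc V (ip V e f * ip V f e') (B e e'))" if "f \<in> F" for f
  proof -
    have "f = (\<Sum>e\<in>E. sc V (ip V f e) e)"
      using orthonormal_expansion[OF E] EF that span_base by metis
    then have "B f f = B (\<Sum>e\<in>E. sc V (ip V f e) e) (\<Sum>e\<in>E. sc V (ip V f e) e)" by simp
    also have "\<dots> = (\<Sum>e\<in>E. \<Sum>e'\<in>E. sc V (cnj (ip V f e) * ip V f e') (B e e'))"
      by (simp only: Bs(1) assms(6), simp only: Bs(2) assms(7) scale_sum_right scale_scale)
    finally show ?thesis by (simp flip: ip_cnj)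
  qed
  then have "(\<Sum>f\<in>F. B f f) = (\<Sum>f\<in>F. \<Sum>e\<in>E. \<Sum>e'\<in>E. sc V (ip V e f * ip V f e') (B e e'))"
    by simp
  also have "\<dots> = (\<Sum>e\<in>E. \<Sum>e'\<in>E. sc V (\<Sum>f\<in>F. ip V e f * ip V f e') (B e e'))"
  proof (subst sum.swap, rule sum.cong[OF refl])
    fix e assume "e \<in> E"
    show "(\<Sum>f\<in>F. \<Sum>e'\<in>E. sc V (ip V e f * ip V f e') (B e e'))
        = (\<Sum>e'\<in>E. sc V (\<Sum>f\<in>F. ip V e f * ip V f e') (B e e'))"
      by (subst sum.swap) (simp add: scale_sum_left)
  qed
  also have "\<dots> = (\<Sum>e\<in>E. \<Sum>e'\<in>E. if e = e' then B e e' else 0)"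
  proof (intro sum.cong refl)
    fix e e' assume e: "e \<in> E" and e': "e' \<in> E"
    have "e = (\<Sum>f\<in>F. sc V (ip V e f) f)"
      using orthonormal_expansion[OF F] EF e span_base by metis
    then have "ip V e e' = ip V (\<Sum>f\<in>F. sc V (ip V e f) f) e'" by simp
    then have "(\<Sum>f\<in>F. ip V e f * ip V f e') = ip V e e'"
      by (simp add: ip_sum_left ip_scale_left)
    then show "sc V (\<Sum>f\<in>F. ip V e f * ip V f e') (B e e') = (if e = e' then B e e' else 0)"
      using E e e' by (simp add: orthonormal_set_def)
  qed
  also have "\<dots> = (\<Sum>e\<in>E. B e e)" using fin by simp
  finally show ?thesis .
qed

section \<open>The grading by eigenvalues of L_0\<close>

lemma Vhom_iff: "a \<in> Vhom V d \<longleftrightarrow> Lop V 0 a = sc V (of_int d) a"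
  by (simp add: Vhom_def)

lemma subspace_Vhom: "subspace (Vhom V d)"
  by (rule subspaceI) (simp_all add: Vhom_iff Lop_add Lop_scale scale_right_distrib mult.commute)

text \<open>Eigenvectors for different eigenvalues are independent. Applying L_0 - l to the relation
  removes \<open>h l\<close> and multiplies each other \<open>h k\<close> by the nonzero number k -
  l, so the induction hypothesis applies to the rescaled family.\<close>

lemma Vhom_independent:
  fixes S :: "int set"
  assumes "finite S" "\<And>k. k \<in> S \<Longrightarrow> h k \<in> Vhom V k" "sum h S = 0"
  shows "\<forall>k\<in>S. h k = 0"
  using assms
proof (induction S arbitrary: h)
  case empty
  then show ?case by simp
next
  case (insert l S)
  have eq: "h l = - sum h S"
    using insert.prems(2) insert.hyps by (simp add: eq_neg_iff_add_eq_0)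
  have "Lop V 0 (h l + sum h S) = sc V (of_int l) (h l) + (\<Sum>k\<in>S. sc V (of_int k) (h k))"
    using insert.prems(1) by (simp add: Lop_add Lop_sum Vhom_iff)
  then have "sc V (of_int l) (h l) + (\<Sum>k\<in>S. sc V (of_int k) (h k)) = 0"
    by (simp add: eq)
  then have "(\<Sum>k\<in>S. sc V (of_int (k - l)) (h k)) = 0"
    by (simp add: eq scale_left_diff_distrib sum_subtractf scale_sum_right add.commute)
  moreover have "sc V (of_int (k - l)) (h k) \<in> Vhom V k" if "k \<in> S" for k
    using insert.prems(1)[of k] that subspace_Vhom subspace_scale by blast
  ultimately have "\<forall>k\<in>S. sc V (of_int (k - l)) (h k) = 0"
    by (intro insert.IH)
  then have "\<forall>k\<in>S. h k = 0" using insert.hyps by auto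
  then show ?case using eq by simp
qed

text \<open>The differences of the two families of components are eigenvectors that sum to zero.
  Uniqueness is what gives the description operator in \<open>hc\<close> its meaning.\<close>

lemma hdecomp_unique:
  assumes f: "hdecomp V a f" and g: "hdecomp V a g"
  shows "f = g"
proof
  fix d
  define S where "S = insert d ({k. f k \<noteq> 0} \<union> {k. g k \<noteq> 0})"
  have S: "finite S" using f g by (simp add: S_def hdecomp_def)
  have "Sum_any f = sum f S"
    by (rule Sum_any.expand_superset[OF S]) (auto simp: S_def)
  moreover have "Sum_any g = sum g S"
    by (rule Sum_any.expand_superset[OF S]) (auto simp: S_def)
  ultimately have "sum f S = sum g S" using f g by (simp add: hdecomp_def)
  then have "(\<Sum>k\<in>int ` S. f (nat k) - g (nat k)) = 0"
    by (simp add: sum.reindex sum_subtractf)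
  moreover have "f (nat k) - g (nat k) \<in> Vhom V k" if "k \<in> int ` S" for k
    using f g that by (auto simp: hdecomp_def intro!: subspace_diff[OF subspace_Vhom])
  ultimately have "\<forall>k\<in>int ` S. f (nat k) - g (nat k) = 0"
    using S by (intro Vhom_independent) auto
  then show "f d = g d" by (auto simp: S_def)
qed

lemma Vhom_neg:
  assumes "a \<in> Vhom V d" "d < 0"
  shows "a = 0"
proof -
  obtain f where f: "hdecomp V a f" using ex_hdecomp by blast
  define S where "S = {k. f k \<noteq> 0}"
  \<comment> \<open>Moving \<open>a\<close> to the other side of its decomposition gives a vanishing
    sum of eigenvectors. All components of the decomposition have degree at least 0, so degree
    \<open>d\<close> carries \<open>- a\<close> alone.\<close>
  define h where "h k = (if k = d then - a else f (nat k))" for k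
  have S: "finite S" using f by (simp add: S_def hdecomp_def)
  have d: "d \<notin> int ` S" using assms(2) by auto
  have "a = sum f S" using f by (simp add: hdecomp_def S_def Sum_any.expand_set)
  moreover have "(\<Sum>k\<in>int ` S. h k) = (\<Sum>k\<in>int ` S. f (nat k))"
    using d by (intro sum.cong) (auto simp: h_def)
  ultimately have "sum h (insert d (int ` S)) = 0"
    using S d by (simp add: sum.reindex h_def)
  moreover have "h k \<in> Vhom V k" if "k \<in> insert d (int ` S)" for k
    using f that assms by (auto simp: h_def hdecomp_def intro!: subspace_neg[OF subspace_Vhom])
  ultimately have "\<forall>k\<in>insert d (int ` S). h k = 0"
    using S by (intro Vhom_independent) auto
  then show ?thesis by (simp add: h_def)
qed

lemma hc_eq: "hdecomp V a f \<Longrightarrow> hc V d a = f d"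
  unfolding hc_def using hdecomp_unique by (intro the_equality) auto

lemma hdecomp_add:
  assumes f: "hdecomp V a f" and g: "hdecomp V b g"
  shows "hdecomp V (a + b) (\<lambda>k. f k + g k)"
  unfolding hdecomp_def
proof (intro conjI allI)
  have "{k. f k + g k \<noteq> 0} \<subseteq> {k. f k \<noteq> 0} \<union> {k. g k \<noteq> 0}" by auto
  then show "finite {k. f k + g k \<noteq> 0}"
    using f g by (auto simp: hdecomp_def intro: finite_subset)
  show "f k + g k \<in> Vhom V (int k)" for k
    using f g by (auto simp: hdecomp_def intro: subspace_add[OF subspace_Vhom])
  show "a + b = Sum_any (\<lambda>k. f k + g k)"
    using f g by (simp add: hdecomp_def Sum_any.distrib)
qed

lemma hdecomp_homogeneous:
  assumes "a \<in> Vhom V (int d)"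
  shows "hdecomp V a (\<lambda>k. if k = d then a else 0)"
proof -
  have "Sum_any (\<lambda>k. if k = d then a else 0) = (\<Sum>k\<in>{d}. if k = d then a else 0)"
    by (rule Sum_any.expand_superset) auto
  then show ?thesis
    using assms subspace_0[OF subspace_Vhom] by (auto simp: hdecomp_def)
qed

section \<open>Graded modes and commutators with L_{-1}, L_0, L_1\<close>

lemma smd_eq:
  assumes "hdecomp V a f" "finite S" "{k. f k \<noteq> 0} \<subseteq> S"
  shows "smd V a m b = (\<Sum>d\<in>S. md V (f d) (m + int d - 1) b)"
  unfolding smd_def hc_eq[OF assms(1)]
  by (rule Sum_any.expand_superset) (use assms in auto)

lemma smd_homogeneous:
  assumes "a \<in> Vhom V (int d)"
  shows "smd V a m b = md V a (m + int d - 1) b"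
proof -
  have "smd V a m b = (\<Sum>k\<in>{d}. md V (if k = d then a else 0) (m + int k - 1) b)"
    by (rule smd_eq[OF hdecomp_homogeneous[OF assms]]) auto
  then show ?thesis by simp
qed

lemma smd_add: "smd V (a + b) m c = smd V a m c + smd V b m c"
proof -
  obtain f g where f: "hdecomp V a f" and g: "hdecomp V b g" using ex_hdecomp by blast
  define S where "S = {k. f k \<noteq> 0} \<union> {k. g k \<noteq> 0}"
  have S: "finite S" using f g by (simp add: S_def hdecomp_def)
  have "smd V (a + b) m c = (\<Sum>d\<in>S. md V (f d + g d) (m + int d - 1) c)"
    by (rule smd_eq[OF hdecomp_add[OF f g] S]) (auto simp: S_def)
  also have "\<dots> = smd V a m c + smd V b m c"
    by (subst (1 2) smd_eq[OF _ S]) (use f g in \<open>auto simp: S_def md_add_left sum.distrib\<close>)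
  finally show ?thesis .
qed

lemma smd_zero_left [simp]: "smd V 0 m c = 0"
  using smd_add[of 0 0 m c] by simp

text \<open>The Borcherds identity at r = 0: the coefficients (0 choose i) leave only i = 0 on the
  right, and for a natural number \<open>m\<close> the sum on the left stops at
  \<open>m\<close>.\<close>

lemma commutator_formula:
  "md V a (int m) (md V b n c) = md V b n (md V a (int m) c)
     + (\<Sum>i\<le>m. sc V (of_nat (m choose i)) (md V (md V a (int i) b) (int m + n - int i) c))"
proof -
  have 1: "((0::complex) gchoose i) = 0" if "i \<noteq> 0" for i
    using that by (cases i) simp_all
  have 2: "(complex_of_int (int m) gchoose i) = of_nat (m choose i)" for i
    by (simp add: binomial_gbinomial)
  have "Sum_any (\<lambda>i::nat. sc V ((-1) ^ i * ((of_int 0 :: complex) gchoose i))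
       (md V a (int m + 0 - int i) (md V b (n + int i) c)
        - sc V ((-1) powi 0) (md V b (n + 0 - int i) (md V a (int m + int i) c))))
     = (\<Sum>i\<in>{0}. sc V ((-1) ^ i * ((of_int 0 :: complex) gchoose i))
       (md V a (int m + 0 - int i) (md V b (n + int i) c)
        - sc V ((-1) powi 0) (md V b (n + 0 - int i) (md V a (int m + int i) c))))"
    by (rule Sum_any.expand_superset) (auto intro: ccontr simp: 1)
  moreover have "Sum_any (\<lambda>i::nat. sc V (complex_of_int (int m) gchoose i)
         (md V (md V a (0 + int i) b) (int m + n - int i) c))
     = (\<Sum>i\<le>m. sc V (of_nat (m choose i)) (md V (md V a (int i) b) (int m + n - int i) c))"
    unfolding 2 by (subst Sum_any.expand_superset[of "{..m}"]) (auto simp: not_le[symmetric] intro: ccontr)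
  ultimately show ?thesis
    using borcherds[of "int m" a 0 b n c] by (simp add: algebra_simps)
qed

text \<open>This and the brackets with L_0 and L_1 below are the commutator formula for the
  conformal vector at m = 0, 1, 2, since L_n is its standard mode n + 1. The modes of L_{-1} b that
  occur are rewritten by \<open>md_translation\<close>.\<close>

lemma Lop_minus1_md: "Lop V (-1) (md V b n c) = md V b n (Lop V (-1) c) - sc V (of_int n) (md V b (n - 1) c)"
  using commutator_formula[of "cv V" 0 b n c] md_translation[of b n c] by (simp add: Lop_def)

lemma Lop_0_md:
  assumes "b \<in> Vhom V d"
  shows "Lop V 0 (md V b n c) = md V b n (Lop V 0 c) + sc V (of_int (d - n - 1)) (md V b n c)"
  using commutator_formula[of "cv V" 1 b n c] md_translation[of b "n + 1" c] assms
  by (simp add: Lop_def Vhom_def md_scale_left scale_left_diff_distrib scale_left_distrib add.commute)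

lemma md_Vhom:
  assumes "b \<in> Vhom V d" "c \<in> Vhom V e"
  shows "md V b n c \<in> Vhom V (d + e - n - 1)"
  using Lop_0_md[OF assms(1), of n c] assms(2)
  by (simp add: Vhom_iff md_scale flip: scale_left_distrib)

lemma Lop_1_md:
  assumes "b \<in> Vhom V d" "Lop V 1 b = 0"
  shows "Lop V 1 (md V b n c) = md V b n (Lop V 1 c) + sc V (of_int (2 * d - n - 2)) (md V b (n + 1) c)"
  using commutator_formula[of "cv V" 2 b n c] md_translation[of b "n + 2" c] assms
  by (simp add: Lop_def Vhom_def md_scale_left scale_left_diff_distrib scale_left_distrib add.commute
      numeral_2_eq_2)

section \<open>Adjoints of the Virasoro modes and the star of a quasi-primary vector\<close>

lemma smd_cv: "smd V (cv V) n b = Lop V n b"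
  using smd_homogeneous[of "cv V" 2 n b] cv_Vhom by (simp add: Lop_def add.commute)

lemma Lop_adjoint: "ip V b (Lop V n c) = ip V (Lop V (- n) b) c"
  using smd_adjoint[of b "cv V" n c] by (simp add: smd_cv star_cv)

lemma Lop_Vhom: "a \<in> Vhom V d \<Longrightarrow> Lop V n a \<in> Vhom V (d - n)"
  using md_Vhom[OF cv_Vhom, of a d "n + 1"] by (simp add: Lop_def)

lemma Lop_vac: "n \<ge> -1 \<Longrightarrow> Lop V n (vac V) = 0"
  by (simp add: Lop_def md_vacuum_nonneg)

text \<open>No axiom states that \<open>star\<close> respects the grading, so
  \<open>star V q\<close> is split into components \<open>f k\<close>. Taking adjoints in the
  bracket of L_1 with a mode of \<open>q\<close> and applying the result to the vacuum shows that
  L_{-1} acts on the vectors \<open>smd V (star V q) n (vac V)\<close> as if \<open>star V q\<close>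
  had weight \<open>d\<close>. Each \<open>f k\<close> obeys the same rule with its own weight
  \<open>k\<close>. Subtracting leaves a relation with factors d - k, which forces
  \<open>f k = 0\<close> for k different from d.\<close>

lemma star_quasiprimary:
  assumes q: "q \<in> Vhom V (int d)" and q1: "Lop V 1 q = 0"
  shows "star V q \<in> Vhom V (int d)"
proof -
  obtain f where f: "hdecomp V (star V q) f" using ex_hdecomp by blast
  define S where "S = {k. f k \<noteq> 0}"
  have S: "finite S" using f by (simp add: S_def hdecomp_def)
  have x: "smd V (star V q) n b = (\<Sum>k\<in>S. md V (f k) (n + int k - 1) b)" for n b
    by (rule smd_eq[OF f S]) (simp add: S_def)
  have L: "Lop V (-1) (smd V (star V q) n (vac V))
      = sc V (- of_int (int d - 1 + n)) (smd V (star V q) (n - 1) (vac V))" for n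
  proof (rule eq_if_ip_left_eq)
    fix c
    have "Lop V 1 (smd V q (-n) c)
        = smd V q (-n) (Lop V 1 c) + sc V (of_int (int d - 1 + n)) (smd V q (1 - n) c)"
      using Lop_1_md[OF q q1, of "- n + int d - 1" c] by (simp add: smd_homogeneous[OF q] algebra_simps)
    then have "ip V (vac V) (Lop V 1 (smd V q (-n) c))
        = ip V (vac V) (smd V q (-n) (Lop V 1 c))
          + of_int (int d - 1 + n) * ip V (vac V) (smd V q (1 - n) c)"
      by (simp only: ip_add_right ip_scale_right complex_cnj_of_int)
    \<comment> \<open>The adjoint of L_1 is L_{-1}, which annihilates the vacuum.\<close>
    moreover have "ip V (vac V) (Lop V 1 (smd V q (-n) c)) = 0"
      by (simp add: Lop_adjoint Lop_vac)
    moreover have "ip V (vac V) (smd V q (-n) (Lop V 1 c)) = ip V (Lop V (-1) (smd V (star V q) n (vac V))) c"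
      by (simp add: smd_adjoint Lop_adjoint)
    moreover have "ip V (vac V) (smd V q (1 - n) c) = ip V (smd V (star V q) (n - 1) (vac V)) c"
      by (simp add: smd_adjoint)
    ultimately have "ip V (Lop V (-1) (smd V (star V q) n (vac V))) c
        + of_int (int d - 1 + n) * ip V (smd V (star V q) (n - 1) (vac V)) c = 0" by simp
    then show "ip V (Lop V (-1) (smd V (star V q) n (vac V))) c
        = ip V (sc V (- of_int (int d - 1 + n)) (smd V (star V q) (n - 1) (vac V))) c"
      by (simp only: ip_scale_left mult_minus_left eq_neg_iff_add_eq_0)
  qed
  \<comment> \<open>\<open>L\<close> is used at n + 1, so that both ways of computing L_{-1} end in
    the mode n + k - 1 of \<open>f k\<close>.\<close>
  have rel: "(\<Sum>k\<in>S. sc V (of_int (int d - int k)) (md V (f k) (n + int k - 1) (vac V))) = 0" for n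
  proof -
    have "Lop V (-1) (smd V (star V q) (n + 1) (vac V))
        = (\<Sum>k\<in>S. sc V (- of_int (n + int k)) (md V (f k) (n + int k - 1) (vac V)))"
      by (simp add: x Lop_sum Lop_minus1_md Lop_vac algebra_simps)
    moreover have "sc V (- of_int (int d - 1 + (n + 1))) (smd V (star V q) (n + 1 - 1) (vac V))
        = (\<Sum>k\<in>S. sc V (- of_int (n + int d)) (md V (f k) (n + int k - 1) (vac V)))"
      by (simp add: x scale_sum_right algebra_simps)
    ultimately have "(\<Sum>k\<in>S. sc V (- of_int (n + int k)) (md V (f k) (n + int k - 1) (vac V)))
        - (\<Sum>k\<in>S. sc V (- of_int (n + int d)) (md V (f k) (n + int k - 1) (vac V))) = 0"
      using L[of "n + 1"] by simp
    then show ?thesis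
      by (simp only: flip: sum_subtractf scale_left_diff_distrib) simp
  qed
  \<comment> \<open>In \<open>rel\<close> at \<open>n = -k\<close> the summands with \<open>j > k\<close> annihilate the vacuum and those with \<open>j < k\<close> vanish by induction.\<close>
  have zero: "k \<noteq> d \<Longrightarrow> f k = 0" for k
  proof (induction k rule: less_induct)
    case (less k)
    let ?g = "\<lambda>j. sc V (of_int (int d - int j)) (md V (f j) (- int k + int j - 1) (vac V))"
    have 0: "?g j = 0" if "j \<noteq> k" for j
    proof (cases "j < k")
      case True
      then show ?thesis using less.IH[of j] by (cases "j = d") auto
    next
      case False
      then show ?thesis using that by (simp add: md_vacuum_nonneg)
    qed
    show ?case
    proof (cases "k \<in> S")
      case True
      have "(\<Sum>j\<in>S. ?g j) = ?g k + (\<Sum>j\<in>S - {k}. ?g j)"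
        using S True by (rule sum.remove)
      also have "(\<Sum>j\<in>S - {k}. ?g j) = 0" by (intro sum.neutral) (use 0 in blast)
      finally have "?g k = 0" using rel[of "- int k"] by simp
      then show ?thesis using less.prems by (simp add: md_vacuum)
    qed (simp add: S_def)
  qed
  have "star V q = Sum_any f" using f by (simp add: hdecomp_def)
  also have "\<dots> = (\<Sum>k\<in>{d}. f k)"
    by (rule Sum_any.expand_superset) (use zero in auto)
  finally have "star V q = f d" by simp
  moreover have "f d \<in> Vhom V (int d)" using f by (simp add: hdecomp_def)
  ultimately show ?thesis by simp
qed

section \<open>Positivity from the Borcherds identity at r = -1\<close>

lemma minus_one_gchoose: "(-1::complex) ^ i * ((-1) gchoose i) = 1"
  by (simp add: gbinomial_minus binomial_gbinomial[symmetric] flip: power_add)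

text \<open>With r = -1 the signs (-1)^i cancel against (-1 choose i), and the minus sign in front
  of the second product is cancelled by (-1) powi (-1). Taking m = d - k and n = k + d - 1 makes the
  two graded modes in each product have opposite indices. As \<open>star\<close> exchanges
  \<open>e\<close> and \<open>star V e\<close>, they are adjoint to each other and the pairing with
  \<open>b\<close> is a squared norm. The left-hand side of the claim is the first of these
  squares.\<close>

lemma positivity_bound:
  fixes d :: nat
  assumes e: "e \<in> Vhom V (int d)" and se: "star V e \<in> Vhom V (int d)"
    and M: "\<And>i. i \<ge> M \<Longrightarrow> md V (star V e) (int i - 1) e = 0"
  shows "(vnorm V (smd V e k b))\<^sup>2 \<le> Re (ip V b (\<Sum>i<M. sc V (of_int (int d - k) gchoose i)
           (md V (md V (star V e) (int i - 1) e) (2 * int d - 1 - int i) b)))"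
proof -
  let ?P = "\<lambda>i::nat. smd V (star V e) (- (k + int i)) (smd V e (k + int i) b)"
  let ?Q = "\<lambda>i::nat. smd V e (k - 1 - int i) (smd V (star V e) (1 - k + int i) b)"
  obtain N1 N2 where N1: "\<forall>n\<ge>N1. md V e n b = 0" and N2: "\<forall>n\<ge>N2. md V (star V e) n b = 0"
    using md_truncation by meson
  \<comment> \<open>From \<open>N\<close> on, the inner modes in \<open>?P\<close> and
    \<open>?Q\<close> annihilate \<open>b\<close>. The successor guarantees that the index 0, whose
    term is kept at the end, is below \<open>N\<close>.\<close>
  define N where "N = Suc (nat (max (N1 - k - int d + 1) (N2 + k - int d)))"
  have N: "?P i = 0" "?Q i = 0" if "i \<ge> N" for i
  proof -
    have "N1 \<le> k + int i + int d - 1" "N2 \<le> 1 - k + int i + int d - 1"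
      using that by (auto simp: N_def)
    then show "?P i = 0" "?Q i = 0"
      using N1 N2 by (simp_all add: smd_homogeneous[OF e] smd_homogeneous[OF se])
  qed
  have "Sum_any (\<lambda>i::nat. sc V ((of_int (int d - k) :: complex) gchoose i)
          (md V (md V (star V e) (-1 + int i) e) ((int d - k) + (k + int d - 1) - int i) b))
      = (\<Sum>i<M. sc V (of_int (int d - k) gchoose i)
           (md V (md V (star V e) (int i - 1) e) (2 * int d - 1 - int i) b))"
  proof (subst Sum_any.expand_superset[of "{..<M}"])
    show "{i. sc V ((of_int (int d - k) :: complex) gchoose i)
          (md V (md V (star V e) (-1 + int i) e) ((int d - k) + (k + int d - 1) - int i) b) \<noteq> 0} \<subseteq> {..<M}"
      using M by (auto simp: not_le[symmetric] intro: ccontr)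
  qed (auto intro!: sum.cong simp: algebra_simps)
  moreover have "Sum_any (\<lambda>i::nat. sc V ((-1) ^ i * ((of_int (-1) :: complex) gchoose i))
       (md V (star V e) ((int d - k) + (-1) - int i) (md V e ((k + int d - 1) + int i) b)
        - sc V ((-1) powi (-1)) (md V e ((k + int d - 1) + (-1) - int i) (md V (star V e) ((int d - k) + int i) b))))
      = Sum_any (\<lambda>i. ?P i + ?Q i)"
    by (simp only: of_int_minus of_int_1 minus_one_gchoose scale_one)
      (simp add: smd_homogeneous[OF e] smd_homogeneous[OF se] algebra_simps)
  moreover have "Sum_any (\<lambda>i. ?P i + ?Q i) = (\<Sum>i<N. ?P i + ?Q i)"
  proof (rule Sum_any.expand_superset)
    show "{i. ?P i + ?Q i \<noteq> 0} \<subseteq> {..<N}"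
      using N by (auto simp: not_le[symmetric] intro: ccontr)
  qed simp
  ultimately have eq: "(\<Sum>i<M. sc V (of_int (int d - k) gchoose i)
           (md V (md V (star V e) (int i - 1) e) (2 * int d - 1 - int i) b)) = (\<Sum>i<N. ?P i + ?Q i)"
    using borcherds[of "int d - k" "star V e" "-1" e "k + int d - 1" b] by (simp only:)
  have P: "Re (ip V b (?P i)) = (vnorm V (smd V e (k + int i) b))\<^sup>2" for i
    by (subst smd_adjoint) (simp add: star_star vnorm_sq add.commute)
  have Q: "Re (ip V b (?Q i)) = (vnorm V (smd V (star V e) (1 - k + int i) b))\<^sup>2" for i
    by (subst smd_adjoint) (simp add: vnorm_sq algebra_simps)
  have "Re (ip V b (\<Sum>i<N. ?P i + ?Q i)) = (\<Sum>i<N. Re (ip V b (?P i)) + Re (ip V b (?Q i)))"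
    by (simp add: ip_sum_right ip_add_right)
  also have "\<dots> \<ge> Re (ip V b (?P 0)) + Re (ip V b (?Q 0))"
  proof -
    have "(\<Sum>i\<in>{0}. Re (ip V b (?P i)) + Re (ip V b (?Q i))) \<le> (\<Sum>i<N. Re (ip V b (?P i)) + Re (ip V b (?Q i)))"
      unfolding P Q by (rule sum_mono2) (auto simp: N_def)
    then show ?thesis by simp
  qed
  finally have "(vnorm V (smd V e k b))\<^sup>2 \<le> Re (ip V b (\<Sum>i<N. ?P i + ?Q i))"
    unfolding P Q by (smt (verit) zero_le_power2 add.right_neutral of_nat_0)
  then show ?thesis by (simp only: eq)
qed

section \<open>Energy bounds as polynomial bounds, and their closure properties\<close>

definition polynomially_bounded :: "'v \<Rightarrow> bool" where
  "polynomially_bounded a \<longleftrightarrow> (\<exists>C p. C \<ge> 0 \<and> (\<forall>m n b. b \<in> Vle V n \<longrightarrow> vnorm V b \<le> 1 \<longrightarrow>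
     vnorm V (smd V a m b) \<le> C * (1 + real_of_int \<bar>m\<bar>) ^ p * (1 + real_of_int \<bar>n\<bar>) ^ p))"

lemma opn_le_iff:
  assumes "x \<ge> 0"
  shows "opn V R n \<le> ennreal x \<longleftrightarrow> (\<forall>b. b \<in> Vle V n \<longrightarrow> vnorm V b \<le> 1 \<longrightarrow> vnorm V (R b) \<le> x)"
  using assms by (auto simp: opn_def Sup_le_iff)

text \<open>Trades the extended-real supremum and the real exponents for a pointwise estimate with a
  single natural exponent. This is possible because both bases are at least 1, so that exponents may
  be enlarged to a common one.\<close>

lemma energy_bounds_iff: "energy_bounds V a \<longleftrightarrow> polynomially_bounded a"
proof
  assume "energy_bounds V a"
  then obtain s C t :: real where nn: "s \<ge> 0" "C \<ge> 0" "t \<ge> 0"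
    and H: "\<And>m n. opn V (smd V a m) n
        \<le> ennreal (C * (1 + real_of_int \<bar>m\<bar>) powr t * (1 + real_of_int \<bar>n\<bar>) powr s)"
    unfolding energy_bounds_def by blast
  define p where "p = nat \<lceil>max s t\<rceil>"
  have p: "s \<le> real p" "t \<le> real p" using nn by (auto simp: p_def) linarith+
  show "polynomially_bounded a"
    unfolding polynomially_bounded_def
  proof (intro exI[of _ C] exI[of _ p] conjI allI impI)
    fix m n b assume b: "b \<in> Vle V n" "vnorm V b \<le> 1"
    have "vnorm V (smd V a m b) \<le> C * (1 + real_of_int \<bar>m\<bar>) powr t * (1 + real_of_int \<bar>n\<bar>) powr s"
      using H[of m n] b nn by (subst (asm) opn_le_iff) auto
    also have "\<dots> \<le> C * (1 + real_of_int \<bar>m\<bar>) powr p * (1 + real_of_int \<bar>n\<bar>) powr p"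
      using nn p by (intro mult_mono powr_mono) auto
    also have "\<dots> = C * (1 + real_of_int \<bar>m\<bar>) ^ p * (1 + real_of_int \<bar>n\<bar>) ^ p"
      by (simp add: powr_realpow)
    finally show "vnorm V (smd V a m b) \<le> C * (1 + real_of_int \<bar>m\<bar>) ^ p * (1 + real_of_int \<bar>n\<bar>) ^ p" .
  qed (rule nn)
next
  assume "polynomially_bounded a"
  then obtain C p where C: "C \<ge> 0" and H: "\<And>m n b. b \<in> Vle V n \<Longrightarrow> vnorm V b \<le> 1 \<Longrightarrow>
     vnorm V (smd V a m b) \<le> C * (1 + real_of_int \<bar>m\<bar>) ^ p * (1 + real_of_int \<bar>n\<bar>) ^ p"
    unfolding polynomially_bounded_def by blast
  show "energy_bounds V a"
    unfolding energy_bounds_def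
  proof (rule exI[of _ "real p"], rule exI[of _ C], rule exI[of _ "real p"], intro conjI allI)
    fix m n
    show "opn V (smd V a m) n
        \<le> ennreal (C * (1 + real_of_int \<bar>m\<bar>) powr real p * (1 + real_of_int \<bar>n\<bar>) powr real p)"
      using C H by (subst opn_le_iff) (simp_all add: powr_realpow)
  qed (simp_all add: C)
qed

lemma polynomially_bounded_zero: "polynomially_bounded 0"
  unfolding polynomially_bounded_def by (intro exI[of _ 0]) simp

lemma polynomially_bounded_add:
  assumes "polynomially_bounded a" "polynomially_bounded b"
  shows "polynomially_bounded (a + b)"
proof -
  obtain C p where C: "C \<ge> 0" and H: "\<And>m n x. x \<in> Vle V n \<Longrightarrow> vnorm V x \<le> 1 \<Longrightarrow>
     vnorm V (smd V a m x) \<le> C * (1 + real_of_int \<bar>m\<bar>) ^ p * (1 + real_of_int \<bar>n\<bar>) ^ p"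
    using assms(1) unfolding polynomially_bounded_def by blast
  obtain D q where D: "D \<ge> 0" and K: "\<And>m n x. x \<in> Vle V n \<Longrightarrow> vnorm V x \<le> 1 \<Longrightarrow>
     vnorm V (smd V b m x) \<le> D * (1 + real_of_int \<bar>m\<bar>) ^ q * (1 + real_of_int \<bar>n\<bar>) ^ q"
    using assms(2) unfolding polynomially_bounded_def by blast
  show ?thesis
    unfolding polynomially_bounded_def
  proof (intro exI[of _ "C + D"] exI[of _ "p + q"] conjI allI impI)
    fix m n x assume x: "x \<in> Vle V n" "vnorm V x \<le> 1"
    let ?m = "1 + real_of_int \<bar>m\<bar>" and ?n = "1 + real_of_int \<bar>n\<bar>"
    have "vnorm V (smd V (a + b) m x) \<le> vnorm V (smd V a m x) + vnorm V (smd V b m x)"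
      unfolding smd_add by (rule vnorm_add)
    also have "\<dots> \<le> C * ?m ^ p * ?n ^ p + D * ?m ^ q * ?n ^ q"
      using H K x by (intro add_mono) auto
    also have "\<dots> \<le> C * ?m ^ (p + q) * ?n ^ (p + q) + D * ?m ^ (p + q) * ?n ^ (p + q)"
      using C D by (intro add_mono mult_mono power_increasing) auto
    finally show "vnorm V (smd V (a + b) m x) \<le> (C + D) * ?m ^ (p + q) * ?n ^ (p + q)"
      by (simp add: algebra_simps)
  qed (use C D in simp)
qed

lemma polynomially_bounded_sum:
  assumes "\<And>i. i \<in> S \<Longrightarrow> polynomially_bounded (f i)"
  shows "polynomially_bounded (sum f S)"
  using assms
  by (induction S rule: infinite_finite_induct)
    (simp_all add: polynomially_bounded_zero polynomially_bounded_add)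

lemma polynomially_bounded_scale:
  assumes "a \<in> Vhom V (int d)" "polynomially_bounded a"
  shows "polynomially_bounded (sc V x a)"
proof -
  obtain C p where C: "C \<ge> 0" and H: "\<And>m n b. b \<in> Vle V n \<Longrightarrow> vnorm V b \<le> 1 \<Longrightarrow>
     vnorm V (smd V a m b) \<le> C * (1 + real_of_int \<bar>m\<bar>) ^ p * (1 + real_of_int \<bar>n\<bar>) ^ p"
    using assms(2) unfolding polynomially_bounded_def by blast
  have "sc V x a \<in> Vhom V (int d)" using assms(1) subspace_Vhom subspace_scale by blast
  then have "smd V (sc V x a) m b = sc V x (smd V a m b)" for m b
    using assms(1) by (simp add: smd_homogeneous md_scale_left)
  then show ?thesis
    unfolding polynomially_bounded_def
    using C H by (intro exI[of _ "cmod x * C"] exI[of _ p])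
      (auto simp: vnorm_scale mult.assoc intro!: mult_left_mono)
qed

text \<open>Absorbs a constant shift of the mode number into the constant in front of 1 +
  |m|.\<close>

lemma add_le_mult_Suc:
  fixes x :: real
  assumes "x \<ge> 0"
  shows "real (N + 1) + x \<le> real (N + 1) * (1 + x)"
  using assms by (simp add: algebra_simps)

text \<open>L_{-1} raises the weight by one and \<open>md_translation\<close> lowers the standard
  mode by one, so the graded mode number stays \<open>m\<close>. The factor -(m + d) that appears
  costs one more power of 1 + |m|.\<close>

lemma polynomially_bounded_translation:
  assumes a: "a \<in> Vhom V (int d)" and ab: "polynomially_bounded a"
  shows "polynomially_bounded (Lop V (-1) a)"
proof -
  obtain C p where C: "C \<ge> 0" and H: "\<And>m n b. b \<in> Vle V n \<Longrightarrow> vnorm V b \<le> 1 \<Longrightarrow>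
     vnorm V (smd V a m b) \<le> C * (1 + real_of_int \<bar>m\<bar>) ^ p * (1 + real_of_int \<bar>n\<bar>) ^ p"
    using ab unfolding polynomially_bounded_def by blast
  have "Lop V (-1) a \<in> Vhom V (int (Suc d))" using Lop_Vhom[OF a, of "-1"] by (simp add: add.commute)
  then have "smd V (Lop V (-1) a) m b = md V (Lop V (-1) a) (m + int d) b" for m b
    using smd_homogeneous[of "Lop V (-1) a" "Suc d" m b] by simp
  then have eq: "smd V (Lop V (-1) a) m b = sc V (- of_int (m + int d)) (smd V a m b)" for m b
    by (simp only: smd_homogeneous[OF a] md_translation)
  show ?thesis
    unfolding polynomially_bounded_def
  proof (intro exI[of _ "real (d + 1) * C"] exI[of _ "Suc p"] conjI allI impI)
    fix m n b assume b: "b \<in> Vle V n" "vnorm V b \<le> 1"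
    let ?m = "1 + real_of_int \<bar>m\<bar>" and ?n = "1 + real_of_int \<bar>n\<bar>"
    have "cmod (- of_int (m + int d)) = real_of_int \<bar>m + int d\<bar>"
      by (simp only: norm_minus_cancel norm_of_int)
    also have "\<dots> \<le> real (d + 1) * ?m"
    proof -
      have "real_of_int \<bar>m + int d\<bar> \<le> real (d + 1) + real_of_int \<bar>m\<bar>" by simp
      also have "\<dots> \<le> real (d + 1) * ?m" by (rule add_le_mult_Suc) simp
      finally show ?thesis .
    qed
    finally have 1: "cmod (- of_int (m + int d)) \<le> real (d + 1) * ?m" .
    have "vnorm V (smd V (Lop V (-1) a) m b) = cmod (- of_int (m + int d)) * vnorm V (smd V a m b)"
      by (simp only: eq vnorm_scale)
    also have "\<dots> \<le> (real (d + 1) * ?m) * (C * ?m ^ p * ?n ^ p)"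
      using 1 H[OF b] by (intro mult_mono) (auto simp: vnorm_nonneg)
    also have "\<dots> \<le> (real (d + 1) * ?m) * (C * ?m ^ p * ?n ^ Suc p)"
      using C by (intro mult_left_mono power_increasing) auto
    finally show "vnorm V (smd V (Lop V (-1) a) m b) \<le> real (d + 1) * C * ?m ^ Suc p * ?n ^ Suc p"
      by (simp add: algebra_simps)
  qed (use C in simp)
qed

section \<open>From bounded traces to bounded vectors\<close>

lemma norm_gchoose_le:
  fixes z :: complex
  shows "cmod (z gchoose i) \<le> (cmod z + real i) ^ i"
proof -
  have "cmod (z gchoose i) = (\<Prod>j = 0..<i. cmod (z - of_nat j)) / fact i"
    by (simp add: gbinomial_prod_rev norm_divide prod_norm)
  also have "\<dots> \<le> (\<Prod>j = 0..<i. cmod (z - of_nat j))"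
    using divide_left_mono[of 1 "fact i" "\<Prod>j = 0..<i. cmod (z - of_nat j)"]
    by (simp add: prod_nonneg)
  also have "\<dots> \<le> (\<Prod>j = 0..<i. cmod z + real i)"
  proof (intro prod_mono conjI)
    fix j assume "j \<in> {0..<i}"
    then show "cmod (z - of_nat j) \<le> cmod z + real i"
      using norm_triangle_ineq4[of z "of_nat j"] by simp
  qed simp
  finally show ?thesis by simp
qed

text \<open>By \<open>positivity_bound\<close> every member of \<open>E\<close> contributes a
  nonnegative quantity, so the one of \<open>e\<close> is at most the sum over \<open>E\<close>, in
  which only the traces \<open>c i\<close> occur. They enter through their zero modes, where 1 + |m|
  is 1, so the dependence on \<open>k\<close> comes from the binomial coefficients alone.\<close>

lemma orthonormal_family_bounded:
  fixes d :: nat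
  assumes E: "finite E" and hom: "\<And>e. e \<in> E \<Longrightarrow> e \<in> Vhom V (int d) \<and> star V e \<in> Vhom V (int d)"
    and inv: "\<And>j. polynomially_bounded (\<Sum>e\<in>E. md V (star V e) j e)"
    and e: "e \<in> E"
  shows "polynomially_bounded e"
proof -
  \<comment> \<open>The traces are numbered from 0, while the modes start at r = -1; hence the
    shift.\<close>
  define c where "c i = (\<Sum>e\<in>E. md V (star V e) (int i - 1) e)" for i :: nat
  have "\<exists>N. \<forall>i\<ge>N. md V (star V f) (int i - 1) f = 0" for f
  proof -
    obtain N where N: "\<forall>n\<ge>N. md V (star V f) n f = 0" using md_truncation by meson
    then show ?thesis by (intro exI[of _ "Suc (nat N)"]) auto
  qed
  then obtain N :: "'v \<Rightarrow> nat" where N: "\<And>f i. i \<ge> N f \<Longrightarrow> md V (star V f) (int i - 1) f = 0"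
    by metis
  \<comment> \<open>One truncation index for all members of \<open>E\<close>, so that the sums for
    different \<open>f\<close> have the same range.\<close>
  define M where "M = Max (insert 0 (N ` E))"
  have M: "md V (star V f) (int i - 1) f = 0" if "f \<in> E" "i \<ge> M" for f i
  proof (rule N)
    have "N f \<le> M" using E that by (auto simp: M_def intro: Max_ge)
    then show "N f \<le> i" using that by simp
  qed
  have c_hom: "c i \<in> Vhom V (2 * int d - int i)" for i
    unfolding c_def
  proof (rule subspace_sum[OF subspace_Vhom])
    fix f assume "f \<in> E"
    then show "md V (star V f) (int i - 1) f \<in> Vhom V (2 * int d - int i)"
      using md_Vhom[of "star V f" "int d" f "int d" "int i - 1"] hom by (simp add: algebra_simps)
  qed
  have c_md: "md V (c i) (2 * int d - 1 - int i) b = smd V (c i) 0 b" for i b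
  proof (cases "2 * int d - int i < 0")
    case True
    then show ?thesis using Vhom_neg[OF c_hom] by simp
  next
    case False
    then show ?thesis
      using smd_homogeneous[of "c i" "nat (2 * int d - int i)" 0 b] c_hom[of i]
      by (simp add: algebra_simps)
  qed
  have "\<exists>C p. C \<ge> 0 \<and> (\<forall>n b. b \<in> Vle V n \<longrightarrow> vnorm V b \<le> 1 \<longrightarrow>
      vnorm V (smd V (c i) 0 b) \<le> C * (1 + real_of_int \<bar>n\<bar>) ^ p)" for i
  proof -
    obtain C p where C: "C \<ge> 0" and H: "\<And>m n b. b \<in> Vle V n \<Longrightarrow> vnorm V b \<le> 1 \<Longrightarrow>
       vnorm V (smd V (c i) m b) \<le> C * (1 + real_of_int \<bar>m\<bar>) ^ p * (1 + real_of_int \<bar>n\<bar>) ^ p"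
      using inv[of "int i - 1"] unfolding polynomially_bounded_def c_def by blast
    show ?thesis
      by (rule exI[of _ C], rule exI[of _ p]) (use C H[where m = 0] in simp)
  qed
  then obtain C p where C: "\<And>i. C i \<ge> 0" and H: "\<And>i n b. b \<in> Vle V n \<Longrightarrow> vnorm V b \<le> 1 \<Longrightarrow>
      vnorm V (smd V (c i) 0 b) \<le> C i * (1 + real_of_int \<bar>n\<bar>) ^ p i"
    by metis
  define P where "P = (\<Sum>i<M. p i)"
  define K where "K = (\<Sum>i<M. real (d + M + 1) ^ M * C i)"
  have K: "K \<ge> 0" unfolding K_def using C by (intro sum_nonneg) simp
  show ?thesis
    unfolding polynomially_bounded_def
  proof (intro exI[of _ "K + 1"] exI[of _ "M + P"] conjI allI impI)
    fix k n b assume b: "b \<in> Vle V n" "vnorm V b \<le> 1"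
    let ?k = "1 + real_of_int \<bar>k\<bar>" and ?n = "1 + real_of_int \<bar>n\<bar>"
    define x where "x i = sc V (of_int (int d - k) gchoose i) (smd V (c i) 0 b)" for i
    let ?T = "\<lambda>f. \<Sum>i<M. sc V (of_int (int d - k) gchoose i)
           (md V (md V (star V f) (int i - 1) f) (2 * int d - 1 - int i) b)"
    have T: "0 \<le> Re (ip V b (?T f))" "(vnorm V (smd V f k b))\<^sup>2 \<le> Re (ip V b (?T f))" if "f \<in> E" for f
    proof -
      show "(vnorm V (smd V f k b))\<^sup>2 \<le> Re (ip V b (?T f))"
        using hom[OF that] M[OF that] by (intro positivity_bound) auto
      then show "0 \<le> Re (ip V b (?T f))" using zero_le_power2 order_trans by blast
    qed
    have "(vnorm V (smd V e k b))\<^sup>2 \<le> Re (ip V b (?T e))" using T(2)[OF e] .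
    also have "\<dots> \<le> (\<Sum>f\<in>E. Re (ip V b (?T f)))"
      using E e T(1) by (intro member_le_sum) auto
    also have "\<dots> = Re (ip V b (\<Sum>f\<in>E. ?T f))" by (simp add: ip_sum_right)
    \<comment> \<open>The binomial coefficient and the outer mode do not depend on \<open>f\<close>,
      since all of \<open>E\<close> has weight \<open>d\<close>; interchanging the sums therefore
      assembles the \<open>c i\<close>.\<close>
    also have "(\<Sum>f\<in>E. ?T f) = (\<Sum>i<M. sc V (of_int (int d - k) gchoose i)
          (md V (c i) (2 * int d - 1 - int i) b))"
      by (subst sum.swap) (simp add: c_def md_sum_left scale_sum_right)
    also have "\<dots> = (\<Sum>i<M. x i)" by (simp only: x_def c_md)
    also have "Re (ip V b (\<Sum>i<M. x i)) = (\<Sum>i<M. Re (ip V b (x i)))" by (simp add: ip_sum_right)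
    also have "\<dots> \<le> (\<Sum>i<M. (real (d + M + 1) ^ M * C i) * ?k ^ M * ?n ^ P)"
    proof (rule sum_mono)
      fix i assume "i \<in> {..<M}"
      then have i: "i < M" by simp
      \<comment> \<open>For fixed \<open>i\<close> this is a polynomial bound in \<open>k\<close>;
        the exponent is then raised to \<open>M\<close> for all \<open>i\<close> at once.\<close>
      have "cmod (of_int (int d - k) gchoose i) \<le> (cmod (of_int (int d - k)) + real i) ^ i"
        by (rule norm_gchoose_le)
      also have "\<dots> \<le> (real (d + M + 1) * ?k) ^ i"
      proof (rule power_mono)
        have "cmod (of_int (int d - k)) + real i \<le> real (d + M + 1) + real_of_int \<bar>k\<bar>"
          unfolding norm_of_int using i by simp
        also have "\<dots> \<le> real (d + M + 1) * ?k" by (rule add_le_mult_Suc) simp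
        finally show "cmod (of_int (int d - k)) + real i \<le> real (d + M + 1) * ?k" .
      qed simp
      also have "\<dots> \<le> (real (d + M + 1) * ?k) ^ M"
        using i add_le_mult_Suc[of "real_of_int \<bar>k\<bar>" "d + M"] by (intro power_increasing) auto
      finally have g: "cmod (of_int (int d - k) gchoose i) \<le> (real (d + M + 1) * ?k) ^ M" .
      have "p i \<le> P" unfolding P_def using i by (intro member_le_sum) auto
      then have "C i * ?n ^ p i \<le> C i * ?n ^ P"
        using C by (intro mult_left_mono power_increasing) auto
      then have h: "vnorm V (smd V (c i) 0 b) \<le> C i * ?n ^ P" using H[OF b, of i] by simp
      have "Re (ip V b (x i)) \<le> cmod (ip V b (x i))" by (rule complex_Re_le_cmod)
      also have "\<dots> \<le> vnorm V b * vnorm V (x i)" by (rule cauchy_schwarz)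
      also have "\<dots> \<le> vnorm V (x i)" using b(2) vnorm_nonneg by (intro mult_left_le_one_le) auto
      also have "\<dots> = cmod (of_int (int d - k) gchoose i) * vnorm V (smd V (c i) 0 b)"
        by (simp add: x_def vnorm_scale)
      also have "\<dots> \<le> (real (d + M + 1) * ?k) ^ M * (C i * ?n ^ P)"
        using g h by (intro mult_mono) (auto simp: vnorm_nonneg)
      also have "\<dots> = (real (d + M + 1) ^ M * C i) * ?k ^ M * ?n ^ P"
        by (simp only: power_mult_distrib ac_simps)
      finally show "Re (ip V b (x i)) \<le> (real (d + M + 1) ^ M * C i) * ?k ^ M * ?n ^ P" .
    qed
    also have "\<dots> = K * ?k ^ M * ?n ^ P" by (simp only: K_def sum_distrib_right)
    also have "\<dots> \<le> (K + 1) * ?k ^ (M + P) * ?n ^ (M + P)"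
      using K by (intro mult_mono power_increasing) auto
    \<comment> \<open>So far the square of the norm is bounded. With \<open>K + 1\<close> in place
      of \<open>K\<close> the bound is at least 1, hence at most its own square, and no root has to
      be estimated.\<close>
    also have "\<dots> \<le> ((K + 1) * ?k ^ (M + P) * ?n ^ (M + P))\<^sup>2"
    proof (rule self_le_power)
      have "1 * 1 * 1 \<le> (K + 1) * ?k ^ (M + P) * ?n ^ (M + P)"
        using K by (intro mult_mono one_le_power) auto
      then show "1 \<le> (K + 1) * ?k ^ (M + P) * ?n ^ (M + P)" by simp
    qed simp
    finally show "vnorm V (smd V e k b) \<le> (K + 1) * ?k ^ (M + P) * ?n ^ (M + P)"
      by (rule power2_le_imp_le) (use K in simp)
  qed (use K in simp)
qed

section \<open>Unitary automorphisms\<close>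

lemma aut_linear:
  assumes "unitary_aut V g"
  shows "g (a + b) = g a + g b" "g (sc V x a) = sc V x (g a)" "g (sum f S) = (\<Sum>i\<in>S. g (f i))"
proof -
  interpret l: Vector_Spaces.linear "sc V" "sc V" g
    using assms by (simp add: unitary_aut_def)
  show "g (a + b) = g a + g b" "g (sc V x a) = sc V x (g a)" "g (sum f S) = (\<Sum>i\<in>S. g (f i))"
    by (rule l.add l.scale l.sum)+
qed

lemma aut_md: "unitary_aut V g \<Longrightarrow> g (md V a n b) = md V (g a) n (g b)"
  and aut_ip: "unitary_aut V g \<Longrightarrow> ip V (g a) (g b) = ip V a b"
  and aut_vac: "unitary_aut V g \<Longrightarrow> g (vac V) = vac V"
  and aut_bij: "unitary_aut V g \<Longrightarrow> bij g"
  by (simp_all add: unitary_aut_def)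

lemma aut_Lop: "unitary_aut V g \<Longrightarrow> g (Lop V n a) = Lop V n (g a)"
  by (simp add: Lop_def unitary_aut_def)

lemma aut_Vhom_iff:
  assumes g: "unitary_aut V g"
  shows "g a \<in> Vhom V d \<longleftrightarrow> a \<in> Vhom V d"
  by (simp add: Vhom_iff inj_eq[OF bij_is_inj[OF aut_bij[OF g]]]
      flip: aut_Lop[OF g] aut_linear(2)[OF g])

section \<open>Quasi-primary vectors under automorphisms and translation\<close>

definition quasiprimary :: "int \<Rightarrow> 'v set" where
  "quasiprimary d = {a \<in> Vhom V d. Lop V 1 a = 0}"

lemma subspace_quasiprimary: "subspace (quasiprimary d)"
  unfolding quasiprimary_def
  by (rule subspaceI)
    (auto simp: Lop_add Lop_scale intro: subspace_0 subspace_add subspace_scale subspace_Vhom)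

lemma aut_quasiprimary_iff:
  assumes g: "unitary_aut V g"
  shows "g a \<in> quasiprimary d \<longleftrightarrow> a \<in> quasiprimary d"
proof -
  have "g 0 = 0" using aut_linear(1)[OF g, of 0 0] by simp
  then have "g (Lop V 1 a) = 0 \<longleftrightarrow> Lop V 1 a = 0"
    using bij_is_inj[OF aut_bij[OF g]] by (metis injD)
  then show ?thesis by (simp add: quasiprimary_def aut_Vhom_iff[OF g] aut_Lop[OF g])
qed

text \<open>\<open>unitary_aut\<close> does not mention \<open>star\<close>, but
  \<open>star V x\<close> is determined by the pairings of mode \<open>d\<close> of \<open>x\<close>
  applied to \<open>c\<close> with the vacuum, and \<open>g\<close> preserves modes, vacuum and
  scalar product. This description needs \<open>star V x\<close> to have weight \<open>d\<close>,
  which \<open>star_quasiprimary\<close> provides.\<close>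

lemma aut_star:
  assumes g: "unitary_aut V g" and q: "q \<in> quasiprimary (int d)"
  shows "g (star V q) = star V (g q)"
proof (rule eq_if_ip_right_eq)
  fix b
  obtain b' where b': "b = g b'" using bij_is_surj[OF aut_bij[OF g]] by blast
  have hom: "q \<in> Vhom V (int d)" "star V q \<in> Vhom V (int d)" "g q \<in> Vhom V (int d)"
    "star V (g q) \<in> Vhom V (int d)"
    using q aut_quasiprimary_iff[OF g, of q "int d"] star_quasiprimary by (auto simp: quasiprimary_def)
  have state: "smd V x (- int d) (vac V) = x" if "x \<in> Vhom V (int d)" for x
    using that by (simp add: smd_homogeneous md_vacuum)
  have adj: "ip V c (star V x) = ip V (smd V x (int d) c) (vac V)" if "star V x \<in> Vhom V (int d)" for x c
    using smd_adjoint[of c "star V x" "- int d" "vac V"] by (simp add: state[OF that] star_star)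
  have "ip V b (g (star V q)) = ip V b' (star V q)" by (simp add: b' aut_ip[OF g])
  also have "\<dots> = ip V (smd V q (int d) b') (vac V)" by (rule adj) (rule hom)
  also have "\<dots> = ip V (g (smd V q (int d) b')) (g (vac V))" by (simp only: aut_ip[OF g])
  also have "\<dots> = ip V (smd V (g q) (int d) b) (vac V)"
    by (simp add: smd_homogeneous[OF hom(1)] smd_homogeneous[OF hom(3)] aut_md[OF g] aut_vac[OF g] b')
  also have "\<dots> = ip V b (star V (g q))" by (rule adj[symmetric]) (rule hom)
  finally show "ip V b (g (star V q)) = ip V b (star V (g q))" .
qed

lemma trace_invariant:
  assumes g: "unitary_aut V g" and E: "orthonormal_set E" and sp: "span E = quasiprimary (int d)"
  shows "g (\<Sum>e\<in>E. md V (star V e) j e) = (\<Sum>e\<in>E. md V (star V e) j e)"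
proof -
  have inj: "inj g" using aut_bij[OF g] by (rule bij_is_inj)
  have lin: "Vector_Spaces.linear (sc V) (sc V) g" using g by (simp add: unitary_aut_def)
  have ons: "orthonormal_set (g ` E)"
    using E inj by (auto simp: orthonormal_set_def aut_ip[OF g] inj_eq)
  have "span (g ` E) = g ` quasiprimary (int d)"
    using module_hom.span_image[OF Vector_Spaces.linear.axioms(3)[OF lin]] sp by metis
  also have "\<dots> = quasiprimary (int d)"
  proof
    show "g ` quasiprimary (int d) \<subseteq> quasiprimary (int d)"
      using aut_quasiprimary_iff[OF g] by blast
    show "quasiprimary (int d) \<subseteq> g ` quasiprimary (int d)"
      using aut_quasiprimary_iff[OF g] bij_is_surj[OF aut_bij[OF g]] by (metis image_iff subsetI surjD)
  qed
  finally have sp': "span E = span (g ` E)" using sp by simp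
  have qp: "e \<in> quasiprimary (int d)" if "e \<in> E" for e
    using sp span_base that by blast
  have "g (\<Sum>e\<in>E. md V (star V e) j e) = (\<Sum>e\<in>E. md V (star V (g e)) j (g e))"
    by (simp add: aut_linear(3)[OF g] aut_md[OF g] aut_star[OF g qp])
  also have "\<dots> = (\<Sum>f\<in>g ` E. md V (star V f) j f)"
    using inj by (subst sum.reindex) (auto intro: inj_on_subset)
  also have "\<dots> = (\<Sum>e\<in>E. md V (star V e) j e)"
    by (rule sesquilinear_trace_basis_independent[OF E ons sp'])
      (simp_all add: star_add star_scale md_add md_add_left md_scale md_scale_left)
  finally show ?thesis .
qed

text \<open>\<open>p\<close> is the orthogonal projection of \<open>a\<close> to the image of
  L_{-1}. Since L_{-1} is adjoint to L_1, the squared norm of L_1 (a - p) is the pairing of a - p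
  with a vector of that image, hence zero.\<close>

lemma quasiprimary_plus_translation:
  assumes "a \<in> Vhom V (int d)"
  obtains q b where "q \<in> quasiprimary (int d)" "b \<in> Vhom V (int d - 1)" "a = q + Lop V (-1) b"
proof -
  obtain B where B: "finite B" "span B = Vhom V (int d - 1)"
  \<comment> \<open>For d = 0 the space in degree -1 is trivial; \<open>Vhom_finite_span\<close>
    covers the natural degrees.\<close>
  proof (cases d)
    case 0
    have "Vhom V (int d - 1) = span {}"
      using 0 Vhom_neg[of _ "int d - 1"] subspace_0[OF subspace_Vhom] by auto
    then show ?thesis using that[of "{}"] by simp
  next
    case (Suc k)
    then show ?thesis using Vhom_finite_span[of k] that by auto
  qed
  have L: "module_hom (sc V) (sc V) (Lop V (-1))"
    using md_linear unfolding Lop_def[abs_def] by (blast dest: Vector_Spaces.linear.axioms(3))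
  have img: "span (Lop V (-1) ` B) = Lop V (-1) ` Vhom V (int d - 1)"
    using module_hom.span_image[OF L] B(2) by metis
  obtain F where F: "orthonormal_set F" "span F = span (Lop V (-1) ` B)"
    using ex_orthonormal_basis_span B(1) by blast
  define p where "p = (\<Sum>f\<in>F. sc V (ip V a f) f)"
  have "p \<in> span F" unfolding p_def by (intro span_sum span_scale span_base)
  then obtain b where b: "b \<in> Vhom V (int d - 1)" "p = Lop V (-1) b" using F(2) img by auto
  have p: "p \<in> Vhom V (int d)" using Lop_Vhom[OF b(1), of "-1"] by (simp add: b(2))
  have hom: "a - p \<in> Vhom V (int d)" using assms p by (rule subspace_diff[OF subspace_Vhom])
  have "Lop V 1 (a - p) \<in> Vhom V (int d - 1)" using Lop_Vhom[OF hom] .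
  then have "Lop V (-1) (Lop V 1 (a - p)) \<in> span F" using F(2) img by blast
  then have "ip V (a - p) (Lop V (-1) (Lop V 1 (a - p))) = 0"
    using orthogonal_residual[OF F(1)] by (simp add: p_def)
  then have "Lop V 1 (a - p) = 0" by (intro ip_self_eq_0) (simp add: Lop_adjoint)
  then have "a - p \<in> quasiprimary (int d)" using hom by (simp add: quasiprimary_def)
  then show ?thesis using that[of "a - p" b] b by simp
qed

theorem energy_bounded_if_fixed_points_bounded:
  assumes G: "\<And>g. g \<in> G \<Longrightarrow> unitary_aut V g"
    and bounded: "\<And>a. a \<in> fixed_points G \<Longrightarrow> energy_bounds V a"
  shows "energy_bounded V"
proof -
  have qp: "polynomially_bounded q" if q: "q \<in> quasiprimary (int d)" for q d
  proof -
    obtain B where B: "finite B" "span B = Vhom V (int d)" using Vhom_finite_span[of d] by blast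
    obtain E where E: "orthonormal_set E" "span E = quasiprimary (int d)"
      using ex_orthonormal_basis[OF subspace_quasiprimary _ B(1), of "int d"]
      unfolding B(2) quasiprimary_def by blast
    have EQ: "E \<subseteq> quasiprimary (int d)" using E(2) span_base by blast
    have hom: "e \<in> Vhom V (int d) \<and> star V e \<in> Vhom V (int d)" if "e \<in> E" for e
      using EQ that star_quasiprimary by (auto simp: quasiprimary_def)
    \<comment> \<open>Here the assumption on \<open>fixed_points G\<close> enters, through the
      invariance of the traces.\<close>
    have "polynomially_bounded (\<Sum>e\<in>E. md V (star V e) j e)" for j
      unfolding energy_bounds_iff[symmetric]
    proof (rule bounded)
      show "(\<Sum>e\<in>E. md V (star V e) j e) \<in> fixed_points G"
        unfolding fixed_points_def using trace_invariant[OF G E] by blast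
    qed
    then have "polynomially_bounded e" if "e \<in> E" for e
      using orthonormal_family_bounded[of E d e] E(1) hom that
      unfolding orthonormal_set_def by blast
    then have "polynomially_bounded (\<Sum>e\<in>E. sc V (ip V q e) e)"
      using hom by (intro polynomially_bounded_sum) (blast intro: polynomially_bounded_scale)
    moreover have "q = (\<Sum>e\<in>E. sc V (ip V q e) e)"
      by (rule orthonormal_expansion[OF E(1)]) (use q E(2) in blast)
    ultimately show ?thesis by (rule ssubst[rotated])
  qed
  have hom: "a \<in> Vhom V (int d) \<Longrightarrow> polynomially_bounded a" for a d
  proof (induction d arbitrary: a)
    case 0
    obtain q b where *: "q \<in> quasiprimary (int 0)" "b \<in> Vhom V (int 0 - 1)" "a = q + Lop V (-1) b"
      using quasiprimary_plus_translation[OF 0] .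
    \<comment> \<open>In weight 0 there is nothing to translate, so the induction starts with a
      quasi-primary vector.\<close>
    then have "b = 0" using Vhom_neg by simp
    then show ?case using * qp[of q 0] by simp
  next
    case (Suc d)
    obtain q b where *: "q \<in> quasiprimary (int (Suc d))" "b \<in> Vhom V (int (Suc d) - 1)"
      "a = q + Lop V (-1) b"
      using quasiprimary_plus_translation[OF Suc.prems] .
    then have b: "b \<in> Vhom V (int d)" by simp
    show ?case
      unfolding *(3)
      by (intro polynomially_bounded_add qp[OF *(1)] polynomially_bounded_translation[OF b] Suc.IH[OF b])
  qed
  show ?thesis
    unfolding energy_bounded_def energy_bounds_iff
  proof
    fix a
    obtain f where f: "hdecomp V a f" using ex_hdecomp by blast
    then have "a = (\<Sum>k | f k \<noteq> 0. f k)" by (simp add: hdecomp_def Sum_any.expand_set)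
    moreover have "polynomially_bounded (\<Sum>k | f k \<noteq> 0. f k)"
      using f hom by (intro polynomially_bounded_sum) (auto simp: hdecomp_def)
    ultimately show "polynomially_bounded a" by simp
  qed
qed

end

theorem mainTheorem7:
  fixes V :: "('v::ab_group_add) uvoa" and G :: "('v \<Rightarrow> 'v) set"
  assumes "is_simple_voa V" and "is_unitary_voa V"
    and "compact_unitary_aut_group V G"
    and "energy_bounded_subalgebra V (fixed_points G)"
  shows "energy_bounded V"
proof -
  interpret unitary_voa V
    by unfold_locales (rule assms(2))
  show ?thesis
    using assms(3,4)
    by (intro energy_bounded_if_fixed_points_bounded[of G])
      (simp_all add: compact_unitary_aut_group_def energy_bounded_subalgebra_def)
qed

end
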